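(* Let $A\in\mathbb{R}^{m\times n}$, $M\in\mathbb{R}^{q\times m}$, $L\in\mathbb{R}^{p\times n}$, and let $G=A^{\top}M^{\top}MA+L^{\top}L$. Then the weighted pseudoinverse $X:=A_{ML}^{\dagger}$ satisfies the equations $$\begin{cases} XAX = X, \\ MAXA=MA, \\ (M^{\top}MAX)^{\top}=M^{\top}MAX, \\ (GXAG^{\dagger})^{\top}=XA, \\ XM^{\dagger}M=X. \end{cases}$$ Moreover, $A_{ML}^{\dagger}$ is the unique matrix $X\in\mathbb{R}^{n\times m}$ satisfying these five equations.
   Context: $\mathcal{N}(\cdot)$ denotes null space, $\mathcal{P}_{\mathcal{S}}$ the Euclidean orthogonal projector onto a subspace $\mathcal{S}$, and $\dagger$ on a matrix (without subscript) the usual Moore-Penrose pseudoinverse. The $ML$-weighted pseudoinverse of $A$ is the matrix $$A_{ML}^{\dagger}:=(I_n-(L\mathcal{P}_{\mathcal{N}(MA)})^{\dagger}L)(MA)^{\dagger}M\in\mathbb{R}^{n\times m}.$$ *)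

theory Defs
  imports "HOL-Analysis.Analysis"
begin

definition null_space :: "real^'n^'m \<Rightarrow> (real^'n) set"
  where "null_space A = {x. A *v x = 0}"

lemma subspace_null_space: "subspace (null_space A)"
  unfolding null_space_def
  by (auto simp: subspace_def matrix_vector_right_distrib matrix_vector_mult_scaleR)

(* Meaningful only when S is a subspace; see lemma orthogonal_projector. *)
definition orthogonal_projector :: "(real^'n) set \<Rightarrow> real^'n^'n"
  where "orthogonal_projector S =
    matrix (\<lambda>x. THE y. y \<in> S \<and> (\<forall>z\<in>S. orthogonal (x - y) z))"

lemma orthogonal_projector_exists_unique:
  fixes S :: "(real^'n) set"
  assumes "subspace S"
  shows "\<exists>!y. y \<in> S \<and> (\<forall>z\<in>S. orthogonal (x - y) z)"
proof -
  obtain y w where yw: "y \<in> span S" "\<And>z. z \<in> span S \<Longrightarrow> orthogonal w z" "x = y + w"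
    using orthogonal_subspace_decomp_exists by metis
  have S: "span S = S" using assms by simp
  show ?thesis
  proof (rule ex1I[of _ y])
    show "y \<in> S \<and> (\<forall>z\<in>S. orthogonal (x - y) z)" using yw S by simp
  next
    fix y' assume y': "y' \<in> S \<and> (\<forall>z\<in>S. orthogonal (x - y') z)"
    have "y - y' \<in> S" using yw S y' assms subspace_diff by metis
    then have "orthogonal (x - y') (y - y')" "orthogonal (x - y) (y - y')"
      using y' yw S by auto
    then have "(y - y') \<bullet> (y - y') = 0"
      by (simp add: orthogonal_def inner_diff_left)
    then show "y' = y" by simp
  qed
qed

lemma orthogonal_projector:
  fixes S :: "(real^'n) set"
  assumes "subspace S"
  shows "orthogonal_projector S *v x \<in> S"
    and "z \<in> S \<Longrightarrow> orthogonal (x - orthogonal_projector S *v x) z"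
proof -
  define f where "f x = (THE y. y \<in> S \<and> (\<forall>z\<in>S. orthogonal (x - y) z))" for x :: "real^'n"
  have f: "f x \<in> S \<and> (\<forall>z\<in>S. orthogonal (x - f x) z)" for x
    unfolding f_def by (rule theI'[OF orthogonal_projector_exists_unique[OF assms]])
  have uniq: "f x = y" if "y \<in> S" "\<forall>z\<in>S. orthogonal (x - y) z" for x y
    using f that orthogonal_projector_exists_unique[OF assms] by blast
  have "linear f"
  proof (rule linearI)
    fix b c r
    show "f (b + c) = f b + f c"
    proof (rule uniq)
      show "f b + f c \<in> S" using f assms subspace_add by blast
      show "\<forall>z\<in>S. orthogonal (b + c - (f b + f c)) z"
        using f[of b] f[of c] by (simp add: orthogonal_def inner_add_left inner_diff_left)
    qed
    show "f (r *\<^sub>R b) = r *\<^sub>R f b"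
    proof (rule uniq)
      show "r *\<^sub>R f b \<in> S" using f assms subspace_mul by blast
      show "\<forall>z\<in>S. orthogonal (r *\<^sub>R b - r *\<^sub>R f b) z"
        using f[of b] by (simp add: orthogonal_def inner_diff_left)
    qed
  qed
  then have "orthogonal_projector S *v x = f x"
    by (simp add: orthogonal_projector_def matrix_works flip: f_def)
  then show "orthogonal_projector S *v x \<in> S"
    and "z \<in> S \<Longrightarrow> orthogonal (x - orthogonal_projector S *v x) z"
    using f by auto
qed

definition is_moore_penrose :: "real^'n^'m \<Rightarrow> real^'m^'n \<Rightarrow> bool"
  where "is_moore_penrose A X \<longleftrightarrow>
    A ** X ** A = A \<and>
    X ** A ** X = X \<and>
    transpose (A ** X) = A ** X \<and>
    transpose (X ** A) = X ** A"

definition moore_penrose :: "real^'n^'m \<Rightarrow> real^'m^'n"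
  where "moore_penrose A = (THE X. is_moore_penrose A X)"

lemma is_moore_penrose_unique:
  assumes "is_moore_penrose A X" and "is_moore_penrose A Y"
  shows "X = Y"
proof -
  have X: "A ** X ** A = A" "X ** A ** X = X" "transpose (A ** X) = A ** X"
      "transpose (X ** A) = X ** A"
    and Y: "A ** Y ** A = A" "Y ** A ** Y = Y" "transpose (A ** Y) = A ** Y"
      "transpose (Y ** A) = Y ** A"
    using assms by (simp_all add: is_moore_penrose_def)
  have "A ** X = transpose ((A ** Y) ** (A ** X))"
    using X(3) Y(1) by (simp add: matrix_mul_assoc)
  also have "\<dots> = (A ** X) ** (A ** Y)"
    unfolding matrix_transpose_mul[of "A ** Y"] X(3) Y(3) ..
  also have "\<dots> = A ** Y"
    using X(1) by (simp add: matrix_mul_assoc)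
  finally have 1: "A ** X = A ** Y" .
  have "X ** A = transpose ((X ** A) ** (Y ** A))"
    using X(4) Y(1) by (simp flip: matrix_mul_assoc)
  also have "\<dots> = (Y ** A) ** (X ** A)"
    unfolding matrix_transpose_mul[of "X ** A"] X(4) Y(4) ..
  also have "\<dots> = Y ** A"
    using X(1) by (simp flip: matrix_mul_assoc)
  finally have 2: "X ** A = Y ** A" .
  have "X = Y ** (A ** X)" using X(2) 2 by (simp add: matrix_mul_assoc)
  also have "\<dots> = Y" using Y(2) 1 by (simp add: matrix_mul_assoc)
  finally show ?thesis .
qed

lemma is_moore_penrose_exists:
  fixes A :: "real^'n^'m"
  shows "\<exists>X. is_moore_penrose A X"
proof -
  define R where "R w b \<longleftrightarrow> (\<forall>x. A *v x = 0 \<longrightarrow> w \<bullet> x = 0) \<and> (\<forall>z. (b - A *v w) \<bullet> (A *v z) = 0)"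
    for w b
  have ex: "\<exists>w. R w b" for b
  proof -
    have "subspace (range ((*v) A))"
      by (intro linear_subspace_image) auto
    then obtain y where "y \<in> range ((*v) A)" "\<forall>z\<in>range ((*v) A). orthogonal (b - y) z"
      using orthogonal_projector_exists_unique by blast
    then obtain u where u: "\<And>z. (b - A *v u) \<bullet> (A *v z) = 0"
      by (auto simp: orthogonal_def)
    obtain v where v: "v \<in> null_space A" "\<forall>z\<in>null_space A. orthogonal (u - v) z"
      using orthogonal_projector_exists_unique[OF subspace_null_space] by blast
    have "A *v (u - v) = A *v u"
      using v by (simp add: null_space_def matrix_vector_mult_diff_distrib)
    then have "R (u - v) b"
      using u v by (auto simp: R_def null_space_def orthogonal_def)
    then show ?thesis ..
  qed
  have uniq: "w = w'" if "R w b" "R w' b" for w w' b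
  proof -
    have "(b - A *v w') \<bullet> (A *v (w - w')) - (b - A *v w) \<bullet> (A *v (w - w')) = 0"
      using that unfolding R_def by simp
    then have "(A *v (w - w')) \<bullet> (A *v (w - w')) = 0"
      by (simp add: inner_diff_left matrix_vector_mult_diff_distrib)
    then have "A *v (w - w') = 0" by simp
    then have "w \<bullet> (w - w') = 0" "w' \<bullet> (w - w') = 0" using that unfolding R_def by blast+
    then have "(w - w') \<bullet> (w - w') = 0" by (simp add: inner_diff_left)
    then show ?thesis by simp
  qed
  obtain g where g: "\<And>b. R (g b) b" using ex by metis
  have lin: "linear g"
  proof (rule linearI)
    fix b c r
    have "R (g b + g c) (b + c)"
      using g[of b] g[of c] unfolding R_def
      by (simp add: inner_add_left inner_diff_left matrix_vector_right_distrib)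
    then show "g (b + c) = g b + g c" using uniq g by blast
    have "R (r *\<^sub>R g b) (r *\<^sub>R b)"
      using g[of b] unfolding R_def
      by (simp add: inner_diff_left matrix_vector_mult_scaleR)
    then show "g (r *\<^sub>R b) = r *\<^sub>R g b" using uniq g by blast
  qed
  define X where "X = matrix g"
  have X: "X *v b = g b" for b
    unfolding X_def using lin by (simp add: matrix_works)
  have AgA: "A *v g (A *v z) = A *v z" for z
  proof -
    have "(A *v z - A *v g (A *v z)) \<bullet> (A *v (z - g (A *v z))) = 0"
      using g unfolding R_def by blast
    then show ?thesis by (simp add: matrix_vector_mult_diff_distrib)
  qed
  have gAg: "g (A *v g b) = g b" for b
  proof -
    have "R (g b) (A *v g b)" using g[of b] unfolding R_def by simp
    then show ?thesis using uniq g by blast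
  qed
  have symI: "transpose B = B" if "\<And>x y. (B *v x) \<bullet> y = x \<bullet> (B *v y)" for B :: "real^'k^'k"
  proof -
    have "x \<bullet> (transpose B *v y - B *v y) = 0" for x y
      using that[of x y] dot_lmul_matrix[of x "transpose B" y]
      by (simp add: inner_diff_right transpose_matrix_vector vector_transpose_matrix)
    then have "transpose B *v y = B *v y" for y
      using inner_eq_zero_iff[of "transpose B *v y - B *v y"] by simp
    then show ?thesis by (simp add: matrix_eq)
  qed
  have AX: "(A *v g b) \<bullet> c = (A *v g b) \<bullet> (A *v g c)" for b c
  proof -
    have "(c - A *v g c) \<bullet> (A *v g b) = 0" using g[of c] unfolding R_def by blast
    then show ?thesis
      by (simp add: inner_diff_left inner_commute[of c] inner_commute[of "A *v g c"])
  qed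
  have "(A *v g b) \<bullet> c = b \<bullet> (A *v g c)" for b c
    using AX[of b c] AX[of c b] by (simp add: inner_commute)
  then have s1: "transpose (A ** X) = A ** X"
    by (intro symI) (simp add: X flip: matrix_vector_mul_assoc)
  have XA: "g (A *v x) \<bullet> y = g (A *v x) \<bullet> g (A *v y)" for x y
  proof -
    have "A *v (y - g (A *v y)) = 0" by (simp add: AgA matrix_vector_mult_diff_distrib)
    then have "g (A *v x) \<bullet> (y - g (A *v y)) = 0" using g unfolding R_def by blast
    then show ?thesis by (simp add: inner_diff_right)
  qed
  have "g (A *v x) \<bullet> y = x \<bullet> g (A *v y)" for x y
    using XA[of x y] XA[of y x] by (simp add: inner_commute)
  then have s2: "transpose (X ** A) = X ** A"
    by (intro symI) (simp add: X flip: matrix_vector_mul_assoc)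
  have "is_moore_penrose A X"
    unfolding is_moore_penrose_def using s1 s2
    by (simp add: matrix_eq X AgA gAg flip: matrix_vector_mul_assoc)
  then show ?thesis ..
qed

lemma is_moore_penrose_moore_penrose: "is_moore_penrose A (moore_penrose A)"
  unfolding moore_penrose_def
  by (rule theI') (use is_moore_penrose_exists is_moore_penrose_unique in blast)

definition weighted_pinv :: "real^'n^'m \<Rightarrow> real^'m^'q \<Rightarrow> real^'n^'p \<Rightarrow> real^'m^'n"
  where "weighted_pinv A M L =
    (mat 1 - moore_penrose (L ** orthogonal_projector (null_space (M ** A))) ** L)
      ** moore_penrose (M ** A) ** M"

end

theory Submission
  imports Defs
begin

text \<open>
  Write \<open>B = M A\<close>. The matrix \<open>E = X A\<close> is the oblique projector with null space \<open>\<N>(B)\<close> for which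
  \<open>G E\<close> is symmetric and whose range lies in that of \<open>G\<close>; the fourth equation encodes the last two
  properties. An idempotent with these properties is unique, so \<open>Y A = X A\<close> for every solution \<open>Y\<close>;
  likewise \<open>M A Y = M A X\<close> because \<open>A Y\<close> is a projector modulo \<open>\<N>(M)\<close> that is self-adjoint with
  respect to \<open>M\<^sup>T M\<close>. Hence \<open>Y = Y A Y = X A Y = X M\<^sup>\<dagger> M A Y = X M\<^sup>\<dagger> M A X = X\<close>.
\<close>

section \<open>Linearity of matrix products and transposes\<close>

lemma matrix_add_rdistrib:
  fixes A B :: "real^'n^'m" and C :: "real^'k^'n"
  shows "(A + B) ** C = A ** C + B ** C"
  by (vector matrix_matrix_mult_def sum.distrib[symmetric] field_simps)

lemma matrix_diff_ldistrib:
  fixes A :: "real^'n^'m" and B C :: "real^'k^'n"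
  shows "A ** (B - C) = A ** B - A ** C"
  by (vector matrix_matrix_mult_def sum_subtractf[symmetric] field_simps)

lemma matrix_diff_rdistrib:
  fixes A B :: "real^'n^'m" and C :: "real^'k^'n"
  shows "(A - B) ** C = A ** C - B ** C"
  by (vector matrix_matrix_mult_def sum_subtractf[symmetric] field_simps)

lemma transpose_add: "transpose (A + B) = transpose A + transpose B"
  for A B :: "real^'n^'m"
  by (vector transpose_def)

lemma transpose_diff: "transpose (A - B) = transpose A - transpose B"
  for A B :: "real^'n^'m"
  by (vector transpose_def)

lemma transpose_zero [simp]: "transpose 0 = (0 :: real^'n^'m)"
  by (vector transpose_def)

section \<open>Gram matrices\<close>

lemma inner_gram_matrix: "x \<bullet> ((transpose A ** A) *v x) = (A *v x) \<bullet> (A *v x)"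
  for A :: "real^'n^'m"
  by (simp add: inner_commute[of x] dot_lmul_matrix flip: matrix_vector_mul_assoc)

text \<open>The quadratic form of the sum at \<open>Z *v v\<close> is the sum of the squared norms
  of the images under \<open>B\<close> and \<open>L\<close>, so both vanish.\<close>

lemma gram_sum_mul_eq_0:
  fixes B :: "real^'n^'m" and L :: "real^'n^'p" and Z :: "real^'k^'n"
  assumes "(transpose B ** B + transpose L ** L) ** Z = 0"
  shows "B ** Z = 0" and "L ** Z = 0"
proof -
  have "B *v (Z *v v) = 0 \<and> L *v (Z *v v) = 0" for v
  proof -
    have "(transpose B ** B + transpose L ** L) *v (Z *v v) = 0"
      by (simp add: assms matrix_vector_mul_assoc)
    then have "(Z *v v) \<bullet> ((transpose B ** B) *v (Z *v v) + (transpose L ** L) *v (Z *v v)) = 0"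
      by (simp add: matrix_vector_mult_add_rdistrib)
    then have "(B *v (Z *v v)) \<bullet> (B *v (Z *v v)) + (L *v (Z *v v)) \<bullet> (L *v (Z *v v)) = 0"
      by (simp only: inner_add_right inner_gram_matrix)
    then show ?thesis
      by (simp add: add_nonneg_eq_0_iff)
  qed
  then show "B ** Z = 0" and "L ** Z = 0"
    by (simp_all add: matrix_eq flip: matrix_vector_mul_assoc)
qed

text \<open>Injectivity of \<open>transpose M\<close> on the range of \<open>M\<close>:
  \<open>gram_sum_mul_eq_0\<close> applies to \<open>U - V\<close> with both Gram terms equal to
  \<open>transpose M ** M\<close>.\<close>

lemma gram_mul_cancel:
  fixes M :: "real^'m^'q" and U V :: "real^'k^'m"
  assumes "transpose M ** M ** U = transpose M ** M ** V"
  shows "M ** U = M ** V"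
proof -
  have "(transpose M ** M + transpose M ** M) ** (U - V) = 0"
    using assms by (simp only: matrix_add_rdistrib matrix_diff_ldistrib) simp
  then have "M ** (U - V) = 0" by (rule gram_sum_mul_eq_0)
  then show ?thesis by (simp add: matrix_diff_ldistrib)
qed

section \<open>Pseudoinverses and null-space projectors\<close>

lemma moore_penrose_eqs:
  shows "A ** moore_penrose A ** A = A"
    and "moore_penrose A ** A ** moore_penrose A = moore_penrose A"
    and "transpose (A ** moore_penrose A) = A ** moore_penrose A"
    and "transpose (moore_penrose A ** A) = moore_penrose A ** A"
  using is_moore_penrose_moore_penrose[of A] by (simp_all add: is_moore_penrose_def)

text \<open>Used to see that a matrix annihilating \<open>transpose A\<close> from the left
  annihilates \<open>moore_penrose A\<close> too.\<close>

lemma moore_penrose_eq_left: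
  "moore_penrose A = transpose A ** transpose (moore_penrose A) ** moore_penrose A"
proof -
  have "moore_penrose A = transpose (moore_penrose A ** A) ** moore_penrose A"
    by (simp only: moore_penrose_eqs)
  then show ?thesis by (simp only: matrix_transpose_mul)
qed

text \<open>Transposition permutes the four Penrose equations, which have only one solution. Hence a
  symmetric matrix has a symmetric pseudoinverse.\<close>

lemma moore_penrose_transpose: "moore_penrose (transpose A) = transpose (moore_penrose A)"
proof -
  have "is_moore_penrose (transpose A) (transpose (moore_penrose A))"
    unfolding is_moore_penrose_def matrix_transpose_mul[symmetric]
    by (simp add: matrix_mul_assoc moore_penrose_eqs)
  then show ?thesis
    using is_moore_penrose_moore_penrose is_moore_penrose_unique by blast
qed

text \<open>\<open>moore_penrose B ** B\<close> is symmetric and idempotent with the null space of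
  \<open>B\<close>, so its complement gives the orthogonal decomposition of each vector.\<close>

lemma orthogonal_projector_null_space:
  "orthogonal_projector (null_space B) = mat 1 - moore_penrose B ** B"
proof -
  let ?P = "orthogonal_projector (null_space B)"
  have "?P *v x = (mat 1 - moore_penrose B ** B) *v x" for x
  proof -
    let ?y = "(mat 1 - moore_penrose B ** B) *v x"
    have "B ** (mat 1 - moore_penrose B ** B) = 0"
      by (simp add: matrix_diff_ldistrib matrix_mul_assoc moore_penrose_eqs)
    then have "?y \<in> null_space B"
      by (simp add: null_space_def matrix_vector_mul_assoc)
    moreover have "orthogonal (x - ?y) z" if "z \<in> null_space B" for z
    proof -
      have "x - ?y = transpose (moore_penrose B ** B) *v x"
        by (simp add: matrix_vector_mult_diff_rdistrib moore_penrose_eqs)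
      then have "(x - ?y) \<bullet> z = x \<bullet> ((moore_penrose B ** B) *v z)"
        by (simp add: dot_lmul_matrix transpose_matrix_vector)
      then show ?thesis
        using that by (simp add: orthogonal_def null_space_def flip: matrix_vector_mul_assoc)
    qed
    ultimately have "?y \<in> null_space B \<and> (\<forall>z\<in>null_space B. orthogonal (x - ?y) z)"
      by blast
    moreover have "?P *v x \<in> null_space B \<and> (\<forall>z\<in>null_space B. orthogonal (x - ?P *v x) z)"
      by (simp add: orthogonal_projector subspace_null_space)
    ultimately show ?thesis
      using orthogonal_projector_exists_unique[OF subspace_null_space, of B x] by blast
  qed
  then show ?thesis by (simp add: matrix_eq)
qed

text \<open>The equation splits into self-adjointness of \<open>E\<close> for the form
  \<open>G\<close> and inclusion of its range in that of \<open>G\<close>. As \<open>G\<close> and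
  its pseudoinverse are symmetric, the transpose on the left reverses the factors and transposes
  only \<open>E\<close>.\<close>

lemma fourth_equation_iff:
  fixes G E :: "real^'n^'n"
  assumes G: "transpose G = G"
  shows "transpose (G ** E ** moore_penrose G) = E \<longleftrightarrow>
    transpose E ** G = G ** E \<and> moore_penrose G ** G ** E = E"
proof -
  let ?H = "moore_penrose G"
  have H: "transpose ?H = ?H" by (metis G moore_penrose_transpose)
  have tr: "transpose (G ** E ** ?H) = ?H ** transpose E ** G"
    by (simp add: matrix_transpose_mul G H matrix_mul_assoc)
  show ?thesis
  proof
    assume L: "transpose (G ** E ** ?H) = E"
    then have E: "?H ** transpose E ** G = E" by (simp add: tr)
    have tE: "transpose E = G ** E ** ?H" by (metis L transpose_transpose)
    \<comment> \<open>After substituting for \<open>transpose E\<close>, the product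
      \<open>G ** ?H ** G\<close> collapses to \<open>G\<close>.\<close>
    have "G ** (?H ** transpose E ** G) = transpose E ** G"
      by (simp add: tE matrix_mul_assoc moore_penrose_eqs)
    then have "transpose E ** G = G ** E"
      by (simp only: E)
    moreover have "?H ** G ** E = E"
    proof -
      have "?H ** G ** (?H ** transpose E ** G) = ?H ** transpose E ** G"
        by (simp add: matrix_mul_assoc moore_penrose_eqs)
      then show ?thesis
        by (simp only: E)
    qed
    ultimately show "transpose E ** G = G ** E \<and> ?H ** G ** E = E" ..
  next
    assume R: "transpose E ** G = G ** E \<and> ?H ** G ** E = E"
    then have "?H ** (transpose E ** G) = ?H ** (G ** E)" by simp
    also have "\<dots> = E" using R by (simp only: matrix_mul_assoc)
    finally show "transpose (G ** E ** ?H) = E" by (simp only: tr matrix_mul_assoc)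
  qed
qed

text \<open>\<open>Bp ** M\<close> yields minimum-norm least-squares solutions. The correction by
  \<open>K\<close> stays in the null space of \<open>B\<close>, so \<open>B ** X\<close> is
  unchanged, while \<open>L ** (X ** A)\<close> becomes the part of \<open>L\<close> orthogonal to
  the range of \<open>L ** P\<close>. This makes \<open>G ** (X ** A)\<close> visibly
  symmetric.\<close>

lemma
  fixes A :: "real^'n^'m" and M :: "real^'m^'q" and L :: "real^'n^'p"
  defines "X \<equiv> weighted_pinv A M L"
    and "G \<equiv> transpose A ** transpose M ** M ** A + transpose L ** L"
  shows weighted_pinv_MAX: "M ** A ** X = M ** A ** moore_penrose (M ** A) ** M"
    and weighted_pinv_XAX: "X ** A ** X = X"
    and weighted_pinv_XMM: "X ** moore_penrose M ** M = X"
    and weighted_pinv_symmetric: "transpose (X ** A) ** G = G ** (X ** A)"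
    and weighted_pinv_range: "moore_penrose G ** G ** (X ** A) = X ** A"
proof -
  define B where "B = M ** A"
  define Bp where "Bp = moore_penrose B"
  define P where "P = mat 1 - Bp ** B"
  define K where "K = moore_penrose (L ** P)"
  define Q where "Q = L ** P ** K"
  have X: "X = (mat 1 - K ** L) ** Bp ** M"
    by (simp add: X_def weighted_pinv_def orthogonal_projector_null_space K_def P_def Bp_def B_def)
  have G: "G = transpose B ** B + transpose L ** L"
    by (simp add: G_def B_def matrix_transpose_mul matrix_mul_assoc)
  have B: "B ** Bp ** B = B" "Bp ** B ** Bp = Bp" "transpose (Bp ** B) = Bp ** B"
    "transpose (B ** Bp) = B ** Bp"
    by (simp_all add: Bp_def moore_penrose_eqs)
  have tP: "transpose P = P" by (simp add: P_def transpose_diff B)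
  have BP: "B ** P = 0" by (simp add: P_def matrix_diff_ldistrib matrix_mul_assoc B)
  have PP: "P ** P = P"
    by (subst (1) P_def) (simp add: matrix_diff_rdistrib BP flip: matrix_mul_assoc)
  \<comment> \<open>As \<open>transpose (L ** P) = P ** transpose L\<close>, the range of
    \<open>K\<close> lies in that of \<open>P\<close>, hence in the null space of
    \<open>B\<close>.\<close>
  have K: "K = P ** transpose L ** transpose K ** K"
    using moore_penrose_eq_left[of "L ** P"] by (simp add: K_def matrix_transpose_mul tP)
  have PK: "P ** K = K"
    by (subst (1 2) K) (simp add: PP matrix_mul_assoc)
  have BK: "B ** K = 0"
    by (metis BP PK matrix_mul_assoc times0_left)
  have BX: "B ** X = B ** Bp ** M"
    by (simp add: X matrix_mul_assoc matrix_diff_ldistrib BK)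
  then show "M ** A ** X = M ** A ** moore_penrose (M ** A) ** M"
    by (simp add: B_def Bp_def)
  have XA: "X ** A = (mat 1 - K ** L) ** Bp ** B"
    by (simp add: X B_def matrix_mul_assoc)
  have "X ** A ** X = (mat 1 - K ** L) ** Bp ** (B ** X)"
    by (simp add: XA matrix_mul_assoc)
  also have "\<dots> = (mat 1 - K ** L) ** (Bp ** B ** Bp) ** M"
    by (simp only: BX matrix_mul_assoc)
  also have "\<dots> = X" by (simp add: B X)
  finally show "X ** A ** X = X" .
  show "X ** moore_penrose M ** M = X"
    unfolding X by (metis matrix_mul_assoc moore_penrose_eqs(1))
  have LK: "L ** K = Q" by (metis PK Q_def matrix_mul_assoc)
  \<comment> \<open>\<open>Q\<close> is the orthogonal projector onto the range of
    \<open>L ** P\<close>.\<close>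
  have tQ: "transpose Q = Q" by (simp add: Q_def K_def moore_penrose_eqs)
  have QLP: "Q ** L ** P = L ** P"
    by (metis K_def Q_def matrix_mul_assoc moore_penrose_eqs(1))
  have "X ** A = (mat 1 - K ** L) ** (mat 1 - P)"
    by (simp add: XA P_def flip: matrix_mul_assoc)
  then have "L ** (X ** A) = (L - Q ** L) ** (mat 1 - P)"
    by (simp add: matrix_mul_assoc matrix_diff_ldistrib LK)
  also have "\<dots> = L - Q ** L"
    by (simp add: matrix_diff_ldistrib matrix_diff_rdistrib QLP)
  finally have LXA: "L ** (X ** A) = L - Q ** L" .
  have BXA: "B ** (X ** A) = B"
  proof -
    have "B ** (X ** A) = B ** Bp ** M ** A" by (simp only: matrix_mul_assoc BX)
    also have "\<dots> = B ** Bp ** B" by (simp add: B_def matrix_mul_assoc)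
    finally show ?thesis by (simp only: B)
  qed
  have GXA: "G ** (X ** A) = transpose B ** B + transpose L ** (L - Q ** L)"
    by (simp add: G matrix_add_rdistrib LXA BXA flip: matrix_mul_assoc)
  then have "transpose (G ** (X ** A)) = G ** (X ** A)"
    by (simp add: transpose_add transpose_diff matrix_transpose_mul matrix_diff_ldistrib
        matrix_diff_rdistrib matrix_mul_assoc tQ)
  moreover have tG: "transpose G = G"
    by (simp add: G transpose_add matrix_transpose_mul)
  ultimately show "transpose (X ** A) ** G = G ** (X ** A)"
    by (simp add: matrix_transpose_mul)
  \<comment> \<open>\<open>Z\<close> projects orthogonally onto the null space of \<open>G\<close>,
    so the range claim amounts to \<open>Z ** (X ** A) = 0\<close>. On that space \<open>B\<close>
    and \<open>L\<close> vanish; hence \<open>Z\<close> kills their transposes, through which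
    \<open>Bp\<close> and \<open>K\<close> factor.\<close>
  define Z where "Z = mat 1 - moore_penrose G ** G"
  have tZ: "transpose Z = Z" by (simp add: Z_def transpose_diff moore_penrose_eqs)
  have "G ** Z = 0"
    by (simp add: Z_def matrix_diff_ldistrib matrix_mul_assoc moore_penrose_eqs)
  then have BZ: "B ** Z = 0" and LZ: "L ** Z = 0"
    using gram_sum_mul_eq_0[of B L Z] by (simp_all flip: G)
  have ZB: "Z ** transpose B = 0" and ZL: "Z ** transpose L = 0"
    by (metis BZ LZ matrix_transpose_mul tZ transpose_zero)+
  have ZBp: "Z ** Bp = 0"
    by (metis Bp_def ZB matrix_mul_assoc times0_left moore_penrose_eq_left)
  have ZP: "Z ** P = Z"
    by (simp add: P_def matrix_diff_ldistrib matrix_mul_assoc ZBp)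
  have ZK: "Z ** K = 0"
    by (subst K) (simp add: matrix_mul_assoc ZP ZL)
  have "Z ** (X ** A) = 0"
    by (simp add: XA matrix_mul_assoc matrix_diff_ldistrib ZK ZBp)
  then show "moore_penrose G ** G ** (X ** A) = X ** A"
    by (simp add: Z_def matrix_diff_rdistrib)
qed

theorem theorem3p7:
  fixes A :: "real^'n^'m" and M :: "real^'m^'q" and L :: "real^'n^'p"
    and G :: "real^'n^'n" and X :: "real^'m^'n"
  assumes "G = transpose A ** transpose M ** M ** A + transpose L ** L"
    and "X = weighted_pinv A M L"
  shows "(X ** A ** X = X \<and>
      M ** A ** X ** A = M ** A \<and>
      transpose (transpose M ** M ** A ** X) = transpose M ** M ** A ** X \<and>
      transpose (G ** X ** A ** moore_penrose G) = X ** A \<and>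
      X ** moore_penrose M ** M = X) \<and>
    (\<forall>Y :: real^'m^'n.
      Y ** A ** Y = Y \<and>
      M ** A ** Y ** A = M ** A \<and>
      transpose (transpose M ** M ** A ** Y) = transpose M ** M ** A ** Y \<and>
      transpose (G ** Y ** A ** moore_penrose G) = Y ** A \<and>
      Y ** moore_penrose M ** M = Y \<longrightarrow>
      Y = X)"
proof -
  have tG: "transpose G = G"
    by (simp add: assms(1) transpose_add matrix_transpose_mul matrix_mul_assoc)
  have fourth: "transpose (G ** Y ** A ** moore_penrose G) = Y ** A \<longleftrightarrow>
      transpose (Y ** A) ** G = G ** (Y ** A) \<and> moore_penrose G ** G ** (Y ** A) = Y ** A" for Y
    using fourth_equation_iff[OF tG, of "Y ** A"] by (simp add: matrix_mul_assoc)

  \<comment> \<open>The five equations\<close>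
  have X1: "X ** A ** X = X"
    by (simp add: assms(2) weighted_pinv_XAX)
  have MAX: "M ** A ** X = M ** A ** moore_penrose (M ** A) ** M"
    by (simp add: assms(2) weighted_pinv_MAX)
  have X2: "M ** A ** X ** A = M ** A"
    using moore_penrose_eqs(1)[of "M ** A"] by (simp only: MAX matrix_mul_assoc)
  have X3: "transpose (transpose M ** M ** A ** X) = transpose M ** M ** A ** X"
  proof -
    \<comment> \<open>\<open>S\<close> is the orthogonal projector onto the range of
      \<open>M ** A\<close>.\<close>
    define S where "S = M ** A ** moore_penrose (M ** A)"
    have S: "transpose S = S" by (simp add: S_def moore_penrose_eqs)
    have "transpose M ** (M ** A ** X) = transpose M ** (S ** M)"
      by (simp only: MAX S_def)
    then have "transpose M ** M ** A ** X = transpose M ** S ** M"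
      by (simp only: matrix_mul_assoc)
    then show ?thesis
      by (simp add: matrix_transpose_mul S matrix_mul_assoc)
  qed
  have X4: "transpose (G ** X ** A ** moore_penrose G) = X ** A"
    unfolding fourth
    unfolding assms by (intro conjI weighted_pinv_symmetric weighted_pinv_range)
  have X5: "X ** moore_penrose M ** M = X"
    by (simp add: assms(2) weighted_pinv_XMM)

  \<comment> \<open>Uniqueness\<close>
  have uniq: "Y = X" if Y1: "Y ** A ** Y = Y"
      and Y2: "M ** A ** Y ** A = M ** A"
      and Y3: "transpose (transpose M ** M ** A ** Y) = transpose M ** M ** A ** Y"
      and Y4: "transpose (G ** Y ** A ** moore_penrose G) = Y ** A"
      and Y5: "Y ** moore_penrose M ** M = Y" for Y
  proof -
    have symX: "transpose (X ** A) ** G = G ** (X ** A)"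
      and ranX: "moore_penrose G ** G ** (X ** A) = X ** A"
      using X4 by (simp_all only: fourth)
    have symY: "transpose (Y ** A) ** G = G ** (Y ** A)"
      and ranY: "moore_penrose G ** G ** (Y ** A) = Y ** A"
      using Y4 by (simp_all only: fourth)
    \<comment> \<open>The fifth equation strips \<open>moore_penrose M ** M\<close> behind
      \<open>Y\<close>. With the same step for \<open>X\<close>, the idempotents
      \<open>Y ** A\<close> and \<open>X ** A\<close> absorb each other on the right: they have the
      same null space.\<close>
    have "Y ** moore_penrose M ** (M ** A ** X ** A) = Y ** moore_penrose M ** (M ** A)"
      by (simp only: X2)
    then have YX: "Y ** A ** (X ** A) = Y ** A"
      by (simp only: matrix_mul_assoc Y5)
    have "X ** moore_penrose M ** (M ** A ** Y ** A) = X ** moore_penrose M ** (M ** A)"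
      by (simp only: Y2)
    then have XY: "X ** A ** (Y ** A) = X ** A"
      by (simp only: matrix_mul_assoc X5)
    \<comment> \<open>Self-adjointness moves both factors to the left of \<open>G\<close> as
      transposes and reverses their order, so that \<open>XY\<close> applies.\<close>
    have "G ** (Y ** A) = G ** (Y ** A ** (X ** A))"
      by (simp only: YX)
    also have "\<dots> = G ** (Y ** A) ** (X ** A)"
      by (simp only: matrix_mul_assoc)
    also have "\<dots> = transpose (Y ** A) ** (G ** (X ** A))"
      unfolding symY[symmetric] by (simp only: matrix_mul_assoc)
    also have "\<dots> = transpose (Y ** A) ** (transpose (X ** A) ** G)"
      by (simp only: symX)
    also have "\<dots> = transpose (X ** A ** (Y ** A)) ** G"
      by (simp only: matrix_transpose_mul matrix_mul_assoc)
    also have "\<dots> = G ** (X ** A)"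
      by (simp only: XY symX)
    finally have "moore_penrose G ** (G ** (Y ** A)) = moore_penrose G ** (G ** (X ** A))"
      by (simp only:)
    \<comment> \<open>On the range of \<open>G\<close>, which contains both ranges,
      \<open>moore_penrose G ** G\<close> is the identity.\<close>
    with ranX ranY have E: "Y ** A = X ** A"
      by (simp only: matrix_mul_assoc)
    let ?W = "transpose M ** M"
    have sX: "transpose (A ** X) ** ?W = ?W ** (A ** X)"
      and sY: "transpose (A ** Y) ** ?W = ?W ** (A ** Y)"
      using X3 Y3 by (simp_all add: matrix_transpose_mul matrix_mul_assoc)
    \<comment> \<open>The same reversal for \<open>A ** X\<close> and \<open>A ** Y\<close> with the
      form \<open>?W\<close>; here absorption is available only after multiplication by
      \<open>M\<close>.\<close>
    have "transpose M ** (M ** A) ** X = transpose M ** (M ** A ** Y ** A) ** X"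
      by (simp only: Y2)
    then have "?W ** (A ** X) = ?W ** (A ** Y) ** (A ** X)"
      by (simp only: matrix_mul_assoc)
    also have "\<dots> = transpose (A ** Y) ** (transpose (A ** X) ** ?W)"
      unfolding sX sY[symmetric] by (simp only: matrix_mul_assoc)
    also have "\<dots> = transpose (?W ** (A ** X) ** (A ** Y))"
      by (simp add: matrix_transpose_mul matrix_mul_assoc)
    also have "?W ** (A ** X) ** (A ** Y) = transpose M ** (M ** A ** X ** A) ** Y"
      by (simp only: matrix_mul_assoc)
    also have "\<dots> = ?W ** (A ** Y)"
      by (simp only: X2 matrix_mul_assoc)
    also have "transpose (?W ** (A ** Y)) = ?W ** (A ** Y)"
      using Y3 by (simp add: matrix_mul_assoc)
    finally have "M ** (A ** X) = M ** (A ** Y)"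
      by (rule gram_mul_cancel)
    \<comment> \<open>By the fifth equation, agreement after multiplication by \<open>M\<close> is
      enough to replace the last \<open>X\<close> in \<open>X ** A ** X\<close>.\<close>
    then have "X ** moore_penrose M ** (M ** (A ** X)) = X ** moore_penrose M ** (M ** (A ** Y))"
      by (simp only:)
    then have XAY: "X ** A ** X = X ** A ** Y"
      by (simp only: matrix_mul_assoc X5)
    have "Y = Y ** A ** Y" by (rule Y1[symmetric])
    also have "\<dots> = X ** A ** Y" by (simp only: E)
    also have "\<dots> = X" by (simp only: X1 flip: XAY)
    finally show "Y = X" .
  qed
  show ?thesis
    by (intro conjI allI impI X1 X2 X3 X4 X5) (elim conjE, rule uniq)
qed

end
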